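(* Let $A$ and $A'$ be any orientations of the set of real roots $\Delta$, let $\sigma=(\sigma_1,\dots,\sigma_r)\in S^r$ be an expression, and let $\tau\le\sigma$ be a subexpression. Then in the walk algebra $\mathcal{A}$ we have $$L(\tau\le\sigma,A)=\sum_{\rho\in\mathscr{D}^{A'}_{A}(\tau\le\sigma)}(-1)^{\#\mathcal{K}^{A'}_{A}(\rho\le\tau\le\sigma)}\,L(\rho\le\sigma,A').$$
   Context: Fix a Kac-Moody root system with index set $I$, Weyl group $W$, simple roots $\{\alpha_i\}_{i\in I}$, simple reflections $S=\{s_i\}_{i\in I}$; write $\alpha_{s_i}=\alpha_i$. "Root" means real root; $\Delta$ is the set of real roots. Expressions: an expression of length $r$ is a tuple $\sigma=(\sigma_1,\dots,\sigma_r)\in S^r$. A subexpression $\tau\le\sigma$ is a tuple $(\tau_1,\dots,\tau_r)$ with $\tau_j\in\{e,\sigma_j\}$ for all $j$ (together with the datum of $\sigma$). For subexpressions $\rho,\tau$ of $\sigma$, $\rho$ is a subexpression of $\tau$ (written $\rho\le\tau\le\sigma$) if $\tau_k=e$ implies $\rho_k=e$. Write $[r]=\{1,\dots,r\}$. Orientations: an orientation $A$ is a decomposition $\Delta=\Delta^A_+\sqcup\Delta^A_-$ with $\Delta^A_+=-\Delta^A_-$ and $\Delta^A_+$ convex: if $\alpha,\beta\in\Delta^A_+$, $a,b>0$ and $a\alpha+b\beta\in\Delta$, then $a\alpha+b\beta\in\Delta^A_+$. Put $\mathrm{sgn}_A(\beta)=+1$ if $\beta\in\Delta^A_+$ and $-1$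 if $\beta\in\Delta^A_-$. Walk algebra: $\mathcal{A}$ is the unital associative $\mathbb{Z}$-algebra generated by $\{c_i^+,c_i^-,f_i^+,f_i^-\}_{i\in I}$ with relations $c_i^+=c_i^-+f_i^+$ and $c_i^-=c_i^++f_i^-$ for each $i\in I$. Write $c^\pm_{s_i}=c^\pm_i$, $f^\pm_{s_i}=f_i^\pm$. Elements $L$: for $\tau\le\sigma$ and an orientation $A$, $L(\tau\le\sigma,A)=x_1\cdots x_r\in\mathcal{A}$, where $x_k=c_{\sigma_k}^{\epsilon_k}$ if $\tau_k=\sigma_k$, $x_k=f_{\sigma_k}^{\epsilon_k}$ if $\tau_k=e$, and $\epsilon_k=\mathrm{sgn}_A(-\tau_1\cdots\tau_k(\alpha_{\sigma_k}))$ (the sign $\pm1$ being read as the superscript $\pm$). Distinguished subexpressions: $\mathscr{D}^{A'}_A(\tau\le\sigma)$ is the set of subexpressions $\rho\le\tau\le\sigma$ such that for every $k\in[r]$ with $\rho_k=e$ and $\tau_k=\sigma_k$ one has $\mathrm{sgn}_A(-\tau_1\cdots\tau_k(\alpha_{\sigma_k}))=\mathrm{sgn}_{A'}(-\rho_1\cdots\rho_k(\alpha_{\sigma_k}))$. Finally, $\mathcal{K}^{A'}_A(\rho\le\tau\le\sigma)=\{k\in[r] : \rho_k=e,\ \tau_k=e,\ \mathrm{sgn}_A(-\tau_1\cdots\tau_k(\alpha_{\sigma_k}))\ne\mathrm{sgn}_{A'}(-\rho_1\cdots\rho_k(\alpha_{\sigma_k}))\}$. *)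

theory Defs
  imports Complex_Main "HOL-Library.Poly_Mapping"
begin

text \<open>
  The index set is the type \<open>'i\<close>, and the roots live in an arbitrary real vector space \<open>'v\<close>
  on which the simple coroots are linear functionals.  Both the root space itself and (a real
  form of) the dual of a Cartan subalgebra are instances: linear independence of the coroots,
  which can fail in the former, is not required.
\<close>

record ('i, 'v) root_datum =
  simple_root :: "'i \<Rightarrow> 'v"
  simple_coroot :: "'i \<Rightarrow> 'v \<Rightarrow> real"

definition kac_moody_root_system :: "('i, 'v::real_vector) root_datum \<Rightarrow> bool" where
  "kac_moody_root_system R \<longleftrightarrow>
     inj (simple_root R) \<and> independent (range (simple_root R)) \<and>
     (\<forall>i. linear (simple_coroot R i)) \<and>
     (\<forall>i. simple_coroot R i (simple_root R i) = 2) \<and>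
     (\<forall>i j. i \<noteq> j \<longrightarrow> simple_coroot R i (simple_root R j) \<in> \<int> \<and>
                       simple_coroot R i (simple_root R j) \<le> 0) \<and>
     (\<forall>i j. simple_coroot R i (simple_root R j) = 0 \<longrightarrow>
            simple_coroot R j (simple_root R i) = 0)"

definition simple_reflection :: "('i, 'v::real_vector) root_datum \<Rightarrow> 'i \<Rightarrow> 'v \<Rightarrow> 'v" where
  "simple_reflection R i v = v - simple_coroot R i v *\<^sub>R simple_root R i"

definition simple_reflections :: "('i, 'v::real_vector) root_datum \<Rightarrow> ('v \<Rightarrow> 'v) set" where
  "simple_reflections R = range (simple_reflection R)"

text \<open>Simple reflections are involutions, so no closure under inverses is needed here.\<close>

inductive_set weyl_group :: "('i, 'v::real_vector) root_datum \<Rightarrow> ('v \<Rightarrow> 'v) set"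
  for R where
  weyl_id: "id \<in> weyl_group R"
| weyl_step: "w \<in> weyl_group R \<Longrightarrow> s \<in> simple_reflections R \<Longrightarrow> s \<circ> w \<in> weyl_group R"

definition real_roots :: "('i, 'v::real_vector) root_datum \<Rightarrow> 'v set" where
  "real_roots R = {w (simple_root R i) | w i. w \<in> weyl_group R}"

definition index_of :: "('i, 'v::real_vector) root_datum \<Rightarrow> ('v \<Rightarrow> 'v) \<Rightarrow> 'i" where
  "index_of R s = (THE i. s = simple_reflection R i)"

definition root_of :: "('i, 'v::real_vector) root_datum \<Rightarrow> ('v \<Rightarrow> 'v) \<Rightarrow> 'v" where
  "root_of R s = simple_root R (index_of R s)"

lemma simple_reflection_simple_root:
  assumes "kac_moody_root_system R"
  shows "simple_reflection R i (simple_root R i) = - simple_root R i"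
  using assms by (simp add: kac_moody_root_system_def simple_reflection_def scaleR_2)

lemma simple_reflection_involution:
  assumes "kac_moody_root_system R"
  shows "simple_reflection R i \<circ> simple_reflection R i = id"
proof
  fix v
  have l: "linear (simple_coroot R i)" and d: "simple_coroot R i (simple_root R i) = 2"
    using assms by (auto simp: kac_moody_root_system_def)
  have "simple_coroot R i (simple_reflection R i v) = - simple_coroot R i v"
    by (simp add: simple_reflection_def linear_diff[OF l] linear_cmul[OF l] d)
  then show "(simple_reflection R i \<circ> simple_reflection R i) v = id v"
    by (simp add: simple_reflection_def)
qed

lemma inj_simple_reflection:
  assumes R: "kac_moody_root_system R"
  shows "inj (simple_reflection R)"
proof (rule injI, rule ccontr)
  fix i j
  assume eq: "simple_reflection R i = simple_reflection R j" and ne: "i \<noteq> j"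
  let ?a = "simple_root R"
  have inj: "inj ?a" and ind: "independent (range ?a)"
    using R by (auto simp: kac_moody_root_system_def)
  have "?a j - simple_coroot R i (?a j) *\<^sub>R ?a i = - ?a j"
    using simple_reflection_simple_root[OF R, of j] eq
    by (simp add: simple_reflection_def fun_eq_iff)
  then have "2 *\<^sub>R ?a j = simple_coroot R i (?a j) *\<^sub>R ?a i"
    by (simp add: scaleR_2 algebra_simps eq_neg_iff_add_eq_0)
  then have "(1/2::real) *\<^sub>R (2 *\<^sub>R ?a j) =
      (1/2::real) *\<^sub>R (simple_coroot R i (?a j) *\<^sub>R ?a i)"
    by (rule arg_cong)
  then have "?a j = (simple_coroot R i (?a j) / 2) *\<^sub>R ?a i"
    by simp
  moreover have "?a i \<in> range ?a - {?a j}"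
    using inj ne by (auto dest: injD)
  ultimately have "?a j \<in> span (range ?a - {?a j})"
    by (metis span_base span_scale)
  then show False
    using ind by (auto simp: dependent_def)
qed

lemma index_of_simple_reflection:
  assumes "kac_moody_root_system R"
  shows "index_of R (simple_reflection R i) = i"
  unfolding index_of_def using inj_simple_reflection[OF assms] by (auto dest: injD)

lemma root_of_simple_reflection:
  assumes "kac_moody_root_system R"
  shows "root_of R (simple_reflection R i) = simple_root R i"
  by (simp add: root_of_def index_of_simple_reflection[OF assms])

text \<open>An orientation is the pair of its positive and its negative part.\<close>

type_synonym 'v orientation = "'v set \<times> 'v set"

definition orientation ::
  "('i, 'v::real_vector) root_datum \<Rightarrow> 'v orientation \<Rightarrow> bool" where
  "orientation R A \<longleftrightarrow>
     fst A \<union> snd A = real_roots R \<and> fst A \<inter> snd A = {} \<and>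
     fst A = uminus ` snd A \<and>
     (\<forall>\<alpha>\<in>fst A. \<forall>\<beta>\<in>fst A. \<forall>a b :: real. a > 0 \<longrightarrow> b > 0 \<longrightarrow>
        a *\<^sub>R \<alpha> + b *\<^sub>R \<beta> \<in> real_roots R \<longrightarrow> a *\<^sub>R \<alpha> + b *\<^sub>R \<beta> \<in> fst A)"

datatype sign = Plus | Minus

text \<open>Only meaningful for real roots; for these, not being positive means being negative.\<close>

definition sgn_of :: "'v orientation \<Rightarrow> 'v \<Rightarrow> sign" where
  "sgn_of A \<beta> = (if \<beta> \<in> fst A then Plus else Minus)"

text \<open>
  The free unital associative ring over a set of generators is the monoid ring, over the integers,
  of the free monoid of words.  \<open>Poly_Mapping\<close> takes the monoid additively, so concatenation of
  words is written \<open>+\<close>; it is not commutative.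
\<close>

datatype 'g word = Word (letters: "'g list")

instantiation word :: (type) monoid_add
begin

definition zero_word :: "'a word" where
  "0 = Word []"

definition plus_word :: "'a word \<Rightarrow> 'a word \<Rightarrow> 'a word" where
  "u + v = Word (letters u @ letters v)"

instance
  by standard (simp_all add: zero_word_def plus_word_def)

end

datatype 'i walk_gen = Gen_c sign 'i | Gen_f sign 'i

type_synonym 'i free_walk = "'i walk_gen word \<Rightarrow>\<^sub>0 int"

definition free_gen :: "'i walk_gen \<Rightarrow> 'i free_walk" where
  "free_gen g = Poly_Mapping.single (Word [g]) 1"

text \<open>The two-sided ideal generated by the defining relations.\<close>

inductive_set walk_ideal :: "'i free_walk set" where
  zero: "0 \<in> walk_ideal"
| rel_plus:
    "free_gen (Gen_c Plus i) - (free_gen (Gen_c Minus i) + free_gen (Gen_f Plus i)) \<in> walk_ideal"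
| rel_minus:
    "free_gen (Gen_c Minus i) - (free_gen (Gen_c Plus i) + free_gen (Gen_f Minus i)) \<in> walk_ideal"
| add: "x \<in> walk_ideal \<Longrightarrow> y \<in> walk_ideal \<Longrightarrow> x + y \<in> walk_ideal"
| mult_left: "x \<in> walk_ideal \<Longrightarrow> a * x \<in> walk_ideal"
| mult_right: "x \<in> walk_ideal \<Longrightarrow> x * a \<in> walk_ideal"

lemma walk_ideal_uminus: "x \<in> walk_ideal \<Longrightarrow> - x \<in> walk_ideal"
  using walk_ideal.mult_left[of x "- 1"] by simp

lemma walk_ideal_minus: "x \<in> walk_ideal \<Longrightarrow> y \<in> walk_ideal \<Longrightarrow> x - y \<in> walk_ideal"
  using walk_ideal.add[of x "- y"] walk_ideal_uminus[of y] by simp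

definition walk_cong :: "'i free_walk \<Rightarrow> 'i free_walk \<Rightarrow> bool" where
  "walk_cong x y \<longleftrightarrow> x - y \<in> walk_ideal"

lemma equivp_walk_cong: "equivp (walk_cong :: 'i free_walk \<Rightarrow> 'i free_walk \<Rightarrow> bool)"
proof (rule equivpI)
  show "reflp (walk_cong :: 'i free_walk \<Rightarrow> _)"
    by (auto simp: reflp_def walk_cong_def walk_ideal.zero)
  show "symp (walk_cong :: 'i free_walk \<Rightarrow> _)"
  proof (rule sympI)
    fix x y :: "'i free_walk"
    assume "walk_cong x y"
    then have "- (x - y) \<in> walk_ideal"
      unfolding walk_cong_def by (rule walk_ideal_uminus)
    then show "walk_cong y x"
      by (simp only: walk_cong_def minus_diff_eq)
  qed
  show "transp (walk_cong :: 'i free_walk \<Rightarrow> _)"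
  proof (rule transpI)
    fix x y z :: "'i free_walk"
    assume "walk_cong x y" "walk_cong y z"
    then have "(x - y) + (y - z) \<in> walk_ideal"
      unfolding walk_cong_def by (rule walk_ideal.add)
    then show "walk_cong x z"
      by (simp add: walk_cong_def)
  qed
qed

quotient_type 'i walk_algebra = "'i free_walk" / walk_cong
  by (rule equivp_walk_cong)

text \<open>The class \<open>ring_1\<close> requires \<open>0 \<noteq> 1\<close>; this is seen on the coefficient of the empty word.\<close>

lemma lookup_times_empty_word:
  fixes x y :: "'g word \<Rightarrow>\<^sub>0 int"
  shows "Poly_Mapping.lookup (x * y) 0 = Poly_Mapping.lookup x 0 * Poly_Mapping.lookup y 0"
proof -
  have *: "(0 = l + q) \<longleftrightarrow> l = 0 \<and> q = 0" for l q :: "'g word"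
    by (cases l; cases q) (auto simp: zero_word_def plus_word_def)
  have "Sum_any (\<lambda>q. Poly_Mapping.lookup y q when 0 = l + q) = (Poly_Mapping.lookup y 0 when l = 0)"
    for l
    by (cases "l = 0") (simp_all add: *)
  then show ?thesis
    by (simp add: lookup_mult mult_when)
qed

lemma walk_ideal_empty_word: "x \<in> walk_ideal \<Longrightarrow> Poly_Mapping.lookup x 0 = 0"
proof (induction rule: walk_ideal.induct)
  case (mult_left x a)
  then show ?case by (simp only: lookup_times_empty_word mult_zero_right)
next
  case (mult_right x a)
  then show ?case by (simp only: lookup_times_empty_word mult_zero_left)
qed (simp_all add: lookup_add lookup_minus free_gen_def lookup_single zero_word_def)

instantiation walk_algebra :: (type) ring_1
begin

lift_definition zero_walk_algebra :: "'a walk_algebra" is 0 .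

lift_definition one_walk_algebra :: "'a walk_algebra" is 1 .

lift_definition plus_walk_algebra ::
  "'a walk_algebra \<Rightarrow> 'a walk_algebra \<Rightarrow> 'a walk_algebra" is "(+)"
  unfolding walk_cong_def by (simp only: add_diff_add walk_ideal.add)

lift_definition uminus_walk_algebra :: "'a walk_algebra \<Rightarrow> 'a walk_algebra" is uminus
  unfolding walk_cong_def by (simp only: minus_diff_minus walk_ideal_uminus)

lift_definition minus_walk_algebra ::
  "'a walk_algebra \<Rightarrow> 'a walk_algebra \<Rightarrow> 'a walk_algebra" is "(-)"
  unfolding walk_cong_def
proof -
  fix a b c d :: "'a free_walk"
  assume "a - b \<in> walk_ideal" "c - d \<in> walk_ideal"
  then have "(a - b) - (c - d) \<in> walk_ideal"
    by (rule walk_ideal_minus)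
  then show "a - c - (b - d) \<in> walk_ideal"
    by (simp add: algebra_simps)
qed

lift_definition times_walk_algebra ::
  "'a walk_algebra \<Rightarrow> 'a walk_algebra \<Rightarrow> 'a walk_algebra" is "(*)"
  unfolding walk_cong_def
proof -
  fix a b c d :: "'a free_walk"
  assume "a - b \<in> walk_ideal" "c - d \<in> walk_ideal"
  then have "(a - b) * c + b * (c - d) \<in> walk_ideal"
    by (intro walk_ideal.add walk_ideal.mult_left walk_ideal.mult_right)
  then show "a * c - b * d \<in> walk_ideal"
    by (simp add: algebra_simps)
qed

instance
proof
  fix a b c :: "'a walk_algebra"
  show "a + b + c = a + (b + c)"
    by transfer (simp only: add.assoc equivp_reflp[OF equivp_walk_cong])
  show "a + b = b + a"
    by transfer (simp only: add.commute equivp_reflp[OF equivp_walk_cong])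
  show "0 + a = a"
    by transfer (simp only: add_0_left equivp_reflp[OF equivp_walk_cong])
  show "- a + a = 0"
    by transfer (simp only: left_minus equivp_reflp[OF equivp_walk_cong])
  show "a - b = a + - b"
    by transfer (simp only: diff_conv_add_uminus equivp_reflp[OF equivp_walk_cong])
  show "a * b * c = a * (b * c)"
    by transfer (simp only: mult.assoc equivp_reflp[OF equivp_walk_cong])
  show "1 * a = a"
    by transfer (simp only: mult_1_left equivp_reflp[OF equivp_walk_cong])
  show "a * 1 = a"
    by transfer (simp only: mult_1_right equivp_reflp[OF equivp_walk_cong])
  show "(a + b) * c = a * c + b * c"
    by transfer (simp only: distrib_right equivp_reflp[OF equivp_walk_cong])
  show "a * (b + c) = a * b + a * c"
    by transfer (simp only: distrib_left equivp_reflp[OF equivp_walk_cong])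
  show "(0 :: 'a walk_algebra) \<noteq> 1"
  proof
    assume "(0 :: 'a walk_algebra) = 1"
    then have "walk_cong (0 :: 'a free_walk) 1"
      by transfer
    then have "(0 :: 'a free_walk) - 1 \<in> walk_ideal"
      by (simp only: walk_cong_def)
    from walk_ideal_empty_word[OF this] show False
      by (simp add: lookup_minus)
  qed
qed

end

lift_definition walk_c :: "sign \<Rightarrow> 'i \<Rightarrow> 'i walk_algebra" is "\<lambda>\<epsilon> i. free_gen (Gen_c \<epsilon> i)" .

lift_definition walk_f :: "sign \<Rightarrow> 'i \<Rightarrow> 'i walk_algebra" is "\<lambda>\<epsilon> i. free_gen (Gen_f \<epsilon> i)" .

lemma walk_c_Plus: "walk_c Plus i = walk_c Minus i + walk_f Plus i"
  by transfer (simp only: walk_cong_def walk_ideal.rel_plus)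

lemma walk_c_Minus: "walk_c Minus i = walk_c Plus i + walk_f Minus i"
  by transfer (simp only: walk_cong_def walk_ideal.rel_minus)

text \<open>
  Expressions and subexpressions are lists of linear maps, the identity being \<open>id\<close>.  Positions are
  counted from \<open>0\<close>, so the prefix product up to and including position \<open>k\<close> has \<open>Suc k\<close> factors.
\<close>

definition expression :: "('i, 'v::real_vector) root_datum \<Rightarrow> ('v \<Rightarrow> 'v) list \<Rightarrow> bool" where
  "expression R \<sigma> \<longleftrightarrow> set \<sigma> \<subseteq> simple_reflections R"

definition subexpression :: "('v \<Rightarrow> 'v) list \<Rightarrow> ('v \<Rightarrow> 'v) list \<Rightarrow> bool" where
  "subexpression \<tau> \<sigma> \<longleftrightarrow>
     length \<tau> = length \<sigma> \<and> (\<forall>j<length \<sigma>. \<tau> ! j \<in> {id, \<sigma> ! j})"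

definition subsubexpression ::
  "('v \<Rightarrow> 'v) list \<Rightarrow> ('v \<Rightarrow> 'v) list \<Rightarrow> ('v \<Rightarrow> 'v) list \<Rightarrow> bool" where
  "subsubexpression \<rho> \<tau> \<sigma> \<longleftrightarrow>
     subexpression \<rho> \<sigma> \<and> subexpression \<tau> \<sigma> \<and>
     (\<forall>k<length \<sigma>. \<tau> ! k = id \<longrightarrow> \<rho> ! k = id)"

definition prefix_prod :: "('v \<Rightarrow> 'v) list \<Rightarrow> nat \<Rightarrow> 'v \<Rightarrow> 'v" where
  "prefix_prod \<tau> k = foldr (\<circ>) (take (Suc k) \<tau>) id"

definition step_sign ::
  "('i, 'v::real_vector) root_datum \<Rightarrow> 'v orientation \<Rightarrow> ('v \<Rightarrow> 'v) list \<Rightarrow>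
    ('v \<Rightarrow> 'v) list \<Rightarrow> nat \<Rightarrow> sign" where
  "step_sign R A \<tau> \<sigma> k = sgn_of A (- prefix_prod \<tau> k (root_of R (\<sigma> ! k)))"

definition walk_L ::
  "('i, 'v::real_vector) root_datum \<Rightarrow> ('v \<Rightarrow> 'v) list \<Rightarrow> ('v \<Rightarrow> 'v) list \<Rightarrow>
    'v orientation \<Rightarrow> 'i walk_algebra" where
  "walk_L R \<tau> \<sigma> A =
     prod_list (map (\<lambda>k. if \<tau> ! k = \<sigma> ! k
                         then walk_c (step_sign R A \<tau> \<sigma> k) (index_of R (\<sigma> ! k))
                         else walk_f (step_sign R A \<tau> \<sigma> k) (index_of R (\<sigma> ! k)))
                    [0..<length \<sigma>])"

definition distinguished ::
  "('i, 'v::real_vector) root_datum \<Rightarrow> 'v orientation \<Rightarrow> 'v orientation \<Rightarrow>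
    ('v \<Rightarrow> 'v) list \<Rightarrow> ('v \<Rightarrow> 'v) list \<Rightarrow> ('v \<Rightarrow> 'v) list set" where
  "distinguished R A A' \<tau> \<sigma> =
     {\<rho>. subsubexpression \<rho> \<tau> \<sigma> \<and>
         (\<forall>k<length \<sigma>. \<rho> ! k = id \<and> \<tau> ! k = \<sigma> ! k \<longrightarrow>
            step_sign R A \<tau> \<sigma> k = step_sign R A' \<rho> \<sigma> k)}"

definition sign_changes ::
  "('i, 'v::real_vector) root_datum \<Rightarrow> 'v orientation \<Rightarrow> 'v orientation \<Rightarrow>
    ('v \<Rightarrow> 'v) list \<Rightarrow> ('v \<Rightarrow> 'v) list \<Rightarrow> ('v \<Rightarrow> 'v) list \<Rightarrow> nat set" where
  "sign_changes R A A' \<rho> \<tau> \<sigma> =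
     {k. k < length \<sigma> \<and> \<rho> ! k = id \<and> \<tau> ! k = id \<and>
         step_sign R A \<tau> \<sigma> k \<noteq> step_sign R A' \<rho> \<sigma> k}"

lemma finite_distinguished: "finite (distinguished R A A' \<tau> \<sigma>)"
proof (rule finite_subset)
  show "distinguished R A A' \<tau> \<sigma> \<subseteq>
      {\<rho>. set \<rho> \<subseteq> insert id (set \<sigma>) \<and> length \<rho> = length \<sigma>}"
  proof
    fix \<rho>
    assume "\<rho> \<in> distinguished R A A' \<tau> \<sigma>"
    then have l: "length \<rho> = length \<sigma>" and e: "\<And>j. j < length \<sigma> \<Longrightarrow> \<rho> ! j \<in> {id, \<sigma> ! j}"
      by (simp_all add: distinguished_def subsubexpression_def subexpression_def)
    have "x \<in> insert id (set \<sigma>)" if x: "x \<in> set \<rho>" for x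
    proof -
      from x obtain j where j: "j < length \<sigma>" "x = \<rho> ! j"
        unfolding in_set_conv_nth l by blast
      have "\<rho> ! j = id \<or> \<rho> ! j = \<sigma> ! j"
        using e[OF j(1)] by blast
      then show ?thesis
        using j nth_mem[OF j(1)] by (elim disjE) (simp_all only: insertI1 insertI2)
    qed
    with l show "\<rho> \<in> {\<rho>. set \<rho> \<subseteq> insert id (set \<sigma>) \<and> length \<rho> = length \<sigma>}"
      by blast
  qed
  show "finite {\<rho>. set \<rho> \<subseteq> insert id (set \<sigma>) \<and> length \<rho> = length \<sigma>}"
    by (rule finite_lists_length_eq) simp
qed

end

theory Submission
  imports Defs
begin

text \<open>
  Both sides are built one position at a time, so the expansion is proved by appending a last
  letter \<open>s\<close> to \<open>\<sigma>\<close>, and everything rests on an identity for a single factor.  Fix a prefix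
  \<open>\<rho>\<close> of a subexpression on the right.  The sign at the new position is \<open>\<epsilon>\<close> on the
  left, while on the right it is \<open>\<delta> u\<close>, depending on the letter \<open>u \<in> {id, s}\<close> appended to
  \<open>\<rho>\<close>.  Since \<open>s\<close> negates its own root, \<open>\<delta> id\<close> and \<open>\<delta> s\<close> are opposite.

  If the left letter is \<open>s\<close>, then \<open>u = s\<close> is always admissible, whereas \<open>u = id\<close> is
  admissible just when \<open>\<epsilon> = \<delta> id\<close>, that is, when \<open>\<epsilon>\<close> is opposite to \<open>\<delta> s\<close>.  So either the signs
  agree and the single admissible term is \<open>c\<^sup>\<epsilon>\<close>, or both terms occur and they are the two
  summands of the defining relation \<open>c\<^sup>\<epsilon> = c\<^sup>-\<^sup>\<epsilon> + f\<^sup>\<epsilon>\<close>.  If the left letter is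
  the identity, then \<open>u = id\<close> is forced; adding the two defining relations gives
  \<open>f\<^sup>+ = - f\<^sup>-\<close>, so a disagreement of the signs costs the factor \<open>-1\<close>, which is exactly what the
  set of sign changes counts.

  The lemma \<open>single_step_expansion\<close> is this identity, \<open>last_signs_opposite\<close> supplies its
  hypothesis, and \<open>sum_distinguished_snoc\<close> splits the sum according to the last letter.
\<close>

section \<open>The walk algebra\<close>

lemma walk_c_opposite:
  assumes "\<epsilon> \<noteq> \<delta>"
  shows "walk_c \<epsilon> i = walk_c \<delta> i + walk_f \<epsilon> i"
  using assms by (metis sign.exhaust walk_c_Plus walk_c_Minus)

text \<open>Substituting one defining relation into the other cancels the generators \<open>c\<close>.\<close>

lemma walk_f_opposite:
  assumes "\<epsilon> \<noteq> \<delta>"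
  shows "walk_f \<epsilon> i = - walk_f \<delta> i"
proof -
  have "walk_c \<epsilon> i = walk_c \<epsilon> i + (walk_f \<delta> i + walk_f \<epsilon> i)"
    using walk_c_opposite[OF assms, of i] walk_c_opposite[OF assms[symmetric], of i]
    by (metis add.assoc)
  then show ?thesis
    by (simp add: eq_neg_iff_add_eq_0 add.commute)
qed

definition step_factor ::
  "('i, 'v::real_vector) root_datum \<Rightarrow> sign \<Rightarrow> ('v \<Rightarrow> 'v) \<Rightarrow> ('v \<Rightarrow> 'v) \<Rightarrow> 'i walk_algebra" where
  "step_factor R \<epsilon> t s =
     (if t = s then walk_c \<epsilon> (index_of R s) else walk_f \<epsilon> (index_of R s))"

text \<open>
  The letters \<open>u\<close> by which a distinguished subexpression may continue below the letter \<open>t\<close>,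
  when the sign is \<open>\<epsilon>\<close> on the side of \<open>t\<close> and \<open>\<delta> u\<close> on the side of \<open>u\<close>.
\<close>

definition admissible_letters ::
  "('v \<Rightarrow> 'v) \<Rightarrow> ('v \<Rightarrow> 'v) \<Rightarrow> sign \<Rightarrow> (('v \<Rightarrow> 'v) \<Rightarrow> sign) \<Rightarrow> ('v \<Rightarrow> 'v) set" where
  "admissible_letters s t \<epsilon> \<delta> =
     {u \<in> {id, s}. (t = id \<longrightarrow> u = id) \<and> (u = id \<and> t = s \<longrightarrow> \<epsilon> = \<delta> u)}"

text \<open>
  For \<open>t = s\<close> this is the defining relation or trivial, for \<open>t = id\<close> it is the antisymmetry of
  \<open>f\<close> or trivial.
\<close>

lemma single_step_expansion:
  assumes "s \<noteq> id" and "t \<in> {id, s}" and opp: "\<delta> id \<noteq> \<delta> s"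
  shows "step_factor R \<epsilon> t s =
    (\<Sum>u\<in>admissible_letters s t \<epsilon> \<delta>.
       (- 1) ^ (if u = id \<and> t = id \<and> \<epsilon> \<noteq> \<delta> u then 1 else 0) * step_factor R (\<delta> u) u s)"
proof (cases "t = id")
  case True
  then have "admissible_letters s t \<epsilon> \<delta> = {id}"
    using assms(1) by (auto simp: admissible_letters_def)
  then show ?thesis
    using True assms(1) walk_f_opposite[of \<epsilon> "\<delta> id" "index_of R s"]
    by (auto simp: step_factor_def)
next
  case False
  then have t: "t = s"
    using assms(2) by simp
  show ?thesis
  proof (cases "\<epsilon> = \<delta> s")
    case True
    then have "admissible_letters s t \<epsilon> \<delta> = {s}"
      using t opp by (auto simp: admissible_letters_def)
    then show ?thesis
      using True t assms(1) by (simp add: step_factor_def)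
  next
    case False
    then have eps: "\<epsilon> = \<delta> id"
      using opp by (metis sign.exhaust)
    then have "admissible_letters s t \<epsilon> \<delta> = {s, id}"
      using t assms(1) by (auto simp: admissible_letters_def)
    then show ?thesis
      using eps t assms(1) walk_c_opposite[OF False, of "index_of R s"]
      by (auto simp: step_factor_def)
  qed
qed

section \<open>Signs at the last position\<close>

lemma weyl_group_foldr:
  assumes "set ws \<subseteq> insert id (simple_reflections R)"
  shows "foldr (\<circ>) ws id \<in> weyl_group R"
  using assms
proof (induction ws)
  case Nil
  show ?case
    by (metis foldr_Nil id_apply weyl_group.weyl_id)
next
  case (Cons w ws)
  have IH: "foldr (\<circ>) ws id \<in> weyl_group R"
    by (rule Cons.IH) (use Cons.prems in simp)
  have step: "foldr (\<circ>) (w # ws) id = w \<circ> foldr (\<circ>) ws id"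
    by simp
  show ?case
  proof (cases "w = id")
    case True
    then show ?thesis
      unfolding step using IH by (simp only: id_comp)
  next
    case False
    then have "w \<in> simple_reflections R"
      using Cons.prems by (metis insert_iff list.set_intros(1) subsetD)
    with IH show ?thesis
      by (simp only: step weyl_group.weyl_step)
  qed
qed

text \<open>
  The elements of a Weyl group are odd maps, which is what carries \<open>s \<alpha>\<^sub>s = - \<alpha>\<^sub>s\<close>
  through a prefix product.
\<close>

lemma weyl_group_minus:
  assumes R: "kac_moody_root_system R" and "w \<in> weyl_group R"
  shows "w (- v) = - w v"
  using assms(2)
proof (induction)
  case weyl_id
  show ?case by simp
next
  case (weyl_step w s)
  then obtain i where s: "s = simple_reflection R i"
    by (auto simp: simple_reflections_def)
  have "linear (simple_coroot R i)"
    using R by (simp add: kac_moody_root_system_def)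
  then have "s (- x) = - s x" for x
    by (simp add: s simple_reflection_def linear_neg)
  then show ?case
    using weyl_step.IH by simp
qed

lemma simple_reflection_neq_id:
  assumes R: "kac_moody_root_system R"
  shows "simple_reflection R i \<noteq> id"
proof
  assume "simple_reflection R i = id"
  then have "simple_root R i = - simple_root R i"
    using simple_reflection_simple_root[OF R, of i] by simp
  then have "2 *\<^sub>R simple_root R i = 0"
    by (simp only: scaleR_2 eq_neg_iff_add_eq_0)
  moreover have "simple_root R i \<noteq> 0"
    using R dependent_zero[of "range (simple_root R)"]
    by (metis kac_moody_root_system_def rangeI)
  ultimately show False by simp
qed

lemma sgn_of_minus:
  assumes "orientation R A" and "\<beta> \<in> real_roots R"
  shows "sgn_of A (- \<beta>) \<noteq> sgn_of A \<beta>"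
proof -
  have A: "fst A \<union> snd A = real_roots R" "fst A \<inter> snd A = {}" "fst A = uminus ` snd A"
    using assms(1) by (auto simp: orientation_def)
  have "- \<beta> \<in> fst A \<longleftrightarrow> \<beta> \<in> snd A"
    unfolding A(3) by force
  then show ?thesis
    using A(1,2) assms(2) by (auto simp: sgn_of_def)
qed

definition last_sign ::
  "('i, 'v::real_vector) root_datum \<Rightarrow> 'v orientation \<Rightarrow> ('v \<Rightarrow> 'v) list \<Rightarrow> ('v \<Rightarrow> 'v) \<Rightarrow>
    ('v \<Rightarrow> 'v) \<Rightarrow> sign" where
  "last_sign R A \<rho> s u = sgn_of A (- foldr (\<circ>) \<rho> id (u (root_of R s)))"

text \<open>
  The two signs are those of \<open>- \<beta>\<close> and \<open>\<beta>\<close> for the real root \<open>\<beta>\<close> obtained by applying the prefix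
  product to the root of \<open>s\<close>.
\<close>

lemma last_signs_opposite:
  assumes R: "kac_moody_root_system R" and "orientation R A"
    and "set \<rho> \<subseteq> insert id (simple_reflections R)" and "s \<in> simple_reflections R"
  shows "last_sign R A \<rho> s id \<noteq> last_sign R A \<rho> s s"
proof -
  obtain i where s: "s = simple_reflection R i"
    using assms(4) by (auto simp: simple_reflections_def)
  let ?w = "foldr (\<circ>) \<rho> id"
  have w: "?w \<in> weyl_group R"
    by (rule weyl_group_foldr) fact
  then have "?w (simple_root R i) \<in> real_roots R"
    by (auto simp: real_roots_def)
  then show ?thesis
    using sgn_of_minus[OF assms(2)] weyl_group_minus[OF R w]
    by (simp add: last_sign_def s root_of_simple_reflection[OF R]
        simple_reflection_simple_root[OF R])
qed

section \<open>Appending a letter\<close>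

lemma foldr_comp_snoc: "foldr (\<circ>) (ws @ [w]) id = foldr (\<circ>) ws id \<circ> w"
  by (induction ws) (auto simp: comp_assoc)

lemma step_sign_snoc_less:
  assumes "length \<rho> = length \<sigma>" and "k < length \<sigma>"
  shows "step_sign R A (\<rho> @ [u]) (\<sigma> @ [s]) k = step_sign R A \<rho> \<sigma> k"
  using assms by (simp add: step_sign_def prefix_prod_def nth_append)

lemma step_sign_snoc_last:
  assumes "length \<rho> = length \<sigma>"
  shows "step_sign R A (\<rho> @ [u]) (\<sigma> @ [s]) (length \<sigma>) = last_sign R A \<rho> s u"
  using assms foldr_comp_snoc[of \<rho> u]
  by (simp add: step_sign_def prefix_prod_def last_sign_def nth_append del: foldr_append)

lemma walk_L_snoc:
  assumes "length \<rho> = length \<sigma>"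
  shows "walk_L R (\<rho> @ [u]) (\<sigma> @ [s]) A =
    walk_L R \<rho> \<sigma> A * step_factor R (last_sign R A \<rho> s u) u s"
proof -
  let ?F = "\<lambda>\<rho> \<sigma> k. if \<rho> ! k = \<sigma> ! k
      then walk_c (step_sign R A \<rho> \<sigma> k) (index_of R (\<sigma> ! k))
      else walk_f (step_sign R A \<rho> \<sigma> k) (index_of R (\<sigma> ! k))"
  have "map (?F (\<rho> @ [u]) (\<sigma> @ [s])) [0..<length \<sigma>] = map (?F \<rho> \<sigma>) [0..<length \<sigma>]"
    using assms by (intro map_cong) (simp_all add: step_sign_snoc_less nth_append)
  moreover have "?F (\<rho> @ [u]) (\<sigma> @ [s]) (length \<sigma>) =
      step_factor R (last_sign R A \<rho> s u) u s"
    using assms by (simp add: step_factor_def step_sign_snoc_last nth_append)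
  moreover have "[0..<length (\<sigma> @ [s])] = [0..<length \<sigma>] @ [length \<sigma>]"
    by simp
  ultimately show ?thesis
    by (simp only: walk_L_def map_append list.map prod_list.append prod_list.Cons prod_list.Nil
        mult_1_right)
qed

lemma card_sign_changes_snoc:
  assumes "length \<rho> = length \<sigma>" and "length \<tau> = length \<sigma>"
  shows "card (sign_changes R A A' (\<rho> @ [u]) (\<tau> @ [t]) (\<sigma> @ [s])) =
    card (sign_changes R A A' \<rho> \<tau> \<sigma>) +
    (if u = id \<and> t = id \<and> last_sign R A \<tau> s t \<noteq> last_sign R A' \<rho> s u then 1 else 0)"
    (is "_ = _ + (if ?P then 1 else 0)")
proof -
  have "sign_changes R A A' (\<rho> @ [u]) (\<tau> @ [t]) (\<sigma> @ [s]) =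
      sign_changes R A A' \<rho> \<tau> \<sigma> \<union> (if ?P then {length \<sigma>} else {})"
    using assms
    by (auto simp: sign_changes_def less_Suc_eq step_sign_snoc_less step_sign_snoc_last nth_append
        split: if_splits)
  moreover have "finite (sign_changes R A A' \<rho> \<tau> \<sigma>)" "length \<sigma> \<notin> sign_changes R A A' \<rho> \<tau> \<sigma>"
    by (auto simp: sign_changes_def)
  ultimately show ?thesis
    by auto
qed

lemma distinguished_length: "\<rho> \<in> distinguished R A A' \<tau> \<sigma> \<Longrightarrow> length \<rho> = length \<sigma>"
  by (simp add: distinguished_def subsubexpression_def subexpression_def)

lemma all_less_length_snoc:
  "(\<forall>k<length (\<sigma> @ [s]). P k) \<longleftrightarrow> (\<forall>k<length \<sigma>. P k) \<and> P (length \<sigma>)"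
  by (auto simp: less_Suc_eq)

lemma subexpression_snoc:
  "subexpression (\<tau> @ [t]) (\<sigma> @ [s]) \<longleftrightarrow> subexpression \<tau> \<sigma> \<and> t \<in> {id, s}"
  unfolding subexpression_def all_less_length_snoc
  by (auto simp: nth_append)

text \<open>
  Being distinguished is a condition at each position that involves only the letters up to it, so
  the new letter affects nothing but the condition at the last position.
\<close>

lemma distinguished_snoc_iff:
  assumes "subexpression (\<tau> @ [t]) (\<sigma> @ [s])"
  shows "\<rho> @ [u] \<in> distinguished R A A' (\<tau> @ [t]) (\<sigma> @ [s]) \<longleftrightarrow>
    \<rho> \<in> distinguished R A A' \<tau> \<sigma> \<and>
    u \<in> admissible_letters s t (last_sign R A \<tau> s t) (last_sign R A' \<rho> s)"
proof (cases "length \<rho> = length \<sigma>")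
  case True
  have "length \<tau> = length \<sigma>"
    using assms by (simp add: subexpression_def)
  with True assms show ?thesis
    unfolding distinguished_def subsubexpression_def mem_Collect_eq subexpression_snoc
      all_less_length_snoc admissible_letters_def
    by (auto simp: nth_append step_sign_snoc_less step_sign_snoc_last)
next
  case False
  then show ?thesis
    using distinguished_length[of "\<rho> @ [u]" R A A' "\<tau> @ [t]" "\<sigma> @ [s]"]
      distinguished_length[of \<rho> R A A' \<tau> \<sigma>]
    by auto
qed

lemma sum_distinguished_snoc:
  assumes "subexpression (\<tau> @ [t]) (\<sigma> @ [s])"
  shows "sum g (distinguished R A A' (\<tau> @ [t]) (\<sigma> @ [s])) =
    (\<Sum>\<rho>\<in>distinguished R A A' \<tau> \<sigma>.
       \<Sum>u\<in>admissible_letters s t (last_sign R A \<tau> s t) (last_sign R A' \<rho> s). g (\<rho> @ [u]))"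
    (is "sum g ?D' = (\<Sum>\<rho>\<in>?D. sum _ (?U \<rho>))")
proof -
  have "finite (?U \<rho>)" for \<rho>
    by (simp add: admissible_letters_def)
  then have "(\<Sum>\<rho>\<in>?D. \<Sum>u\<in>?U \<rho>. g (\<rho> @ [u])) = (\<Sum>(\<rho>, u)\<in>Sigma ?D ?U. g (\<rho> @ [u]))"
    by (simp add: sum.Sigma finite_distinguished)
  also have "\<dots> = sum g ?D'"
  proof (rule sum.reindex_bij_witness[where j = "\<lambda>(\<rho>, u). \<rho> @ [u]"
        and i = "\<lambda>\<rho>. (butlast \<rho>, last \<rho>)"])
    fix \<rho>
    assume \<rho>: "\<rho> \<in> ?D'"
    then have "\<rho> \<noteq> []"
      by (auto dest: distinguished_length)
    then have snoc: "butlast \<rho> @ [last \<rho>] = \<rho>"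
      by simp
    then show "(case (butlast \<rho>, last \<rho>) of (\<rho>, u) \<Rightarrow> \<rho> @ [u]) = \<rho>"
      by simp
    show "(butlast \<rho>, last \<rho>) \<in> Sigma ?D ?U"
      using \<rho> distinguished_snoc_iff[OF assms, of "butlast \<rho>" "last \<rho>" R A A']
      by (simp add: snoc)
  qed (auto simp: distinguished_snoc_iff[OF assms])
  finally show ?thesis
    by simp
qed

lemma distinguished_letters:
  assumes "\<rho> \<in> distinguished R A A' \<tau> \<sigma>" and "expression R \<sigma>"
  shows "set \<rho> \<subseteq> insert id (simple_reflections R)"
proof
  fix x
  assume "x \<in> set \<rho>"
  then obtain k where k: "k < length \<rho>" "x = \<rho> ! k"
    unfolding in_set_conv_nth by blast
  have len: "length \<rho> = length \<sigma>"
    using assms(1) by (rule distinguished_length)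
  then have k_less: "k < length \<sigma>"
    using k(1) by (simp only:)
  have "\<rho> ! k \<in> {id, \<sigma> ! k}"
    using assms(1) k_less by (simp add: distinguished_def subsubexpression_def subexpression_def)
  moreover have "\<sigma> ! k \<in> simple_reflections R"
    using assms(2) nth_mem[OF k_less] unfolding expression_def by (rule subsetD)
  ultimately show "x \<in> insert id (simple_reflections R)"
    unfolding k(2) by (metis insert_iff singletonD)
qed

lemma times_minus_one_power_left:
  "x * ((- 1) ^ m * y) = (- 1) ^ m * (x * y)" for x y :: "'a::ring_1"
  by (cases "even m") simp_all

section \<open>The expansion\<close>

theorem theorem4p6:
  fixes R :: "('i, 'v::real_vector) root_datum"
    and A A' :: "'v orientation"
    and \<sigma> \<tau> :: "('v \<Rightarrow> 'v) list"
  assumes "kac_moody_root_system R"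
    and "orientation R A" and "orientation R A'"
    and "expression R \<sigma>" and "subexpression \<tau> \<sigma>"
  shows "walk_L R \<tau> \<sigma> A =
    (\<Sum>\<rho>\<in>distinguished R A A' \<tau> \<sigma>.
       (- 1) ^ card (sign_changes R A A' \<rho> \<tau> \<sigma>) * walk_L R \<rho> \<sigma> A')"
  using assms(4,5)
proof (induction \<sigma> arbitrary: \<tau> rule: rev_induct)
  case Nil
  then have "distinguished R A A' \<tau> [] = {[]}"
    by (auto simp: distinguished_def subsubexpression_def subexpression_def)
  then show ?case
    by (simp add: walk_L_def sign_changes_def)
next
  case (snoc s \<sigma>)
  from snoc.prems(2) obtain \<tau>\<^sub>0 t where \<tau>: "\<tau> = \<tau>\<^sub>0 @ [t]"
    by (cases \<tau> rule: rev_cases) (auto simp: subexpression_def)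
  have sub: "subexpression \<tau>\<^sub>0 \<sigma>" and t: "t \<in> {id, s}"
    using snoc.prems(2) by (simp_all add: \<tau> subexpression_snoc)
  then have len: "length \<tau>\<^sub>0 = length \<sigma>"
    by (simp add: subexpression_def)
  have expr: "expression R \<sigma>" and s: "s \<in> simple_reflections R"
    using snoc.prems(1) by (simp_all add: expression_def)
  have s_id: "s \<noteq> id"
    using s simple_reflection_neq_id[OF assms(1)] by (auto simp: simple_reflections_def)
  let ?D = "distinguished R A A' \<tau>\<^sub>0 \<sigma>"
  let ?n = "\<lambda>\<rho>. card (sign_changes R A A' \<rho> \<tau>\<^sub>0 \<sigma>)"
  let ?\<epsilon> = "last_sign R A \<tau>\<^sub>0 s t"
  let ?\<delta> = "\<lambda>\<rho>. last_sign R A' \<rho> s"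
  let ?m = "\<lambda>\<rho> u. if u = id \<and> t = id \<and> ?\<epsilon> \<noteq> ?\<delta> \<rho> u then 1 else 0 :: nat"
  have "walk_L R \<tau> (\<sigma> @ [s]) A = walk_L R \<tau>\<^sub>0 \<sigma> A * step_factor R ?\<epsilon> t s"
    by (simp only: \<tau> walk_L_snoc[OF len])
  also have "\<dots> = (\<Sum>\<rho>\<in>?D. ((- 1) ^ ?n \<rho> * walk_L R \<rho> \<sigma> A') * step_factor R ?\<epsilon> t s)"
    by (simp only: snoc.IH[OF expr sub] sum_distrib_right)
  also have "\<dots> = (\<Sum>\<rho>\<in>?D. \<Sum>u\<in>admissible_letters s t ?\<epsilon> (?\<delta> \<rho>).
      (- 1) ^ card (sign_changes R A A' (\<rho> @ [u]) \<tau> (\<sigma> @ [s])) * walk_L R (\<rho> @ [u]) (\<sigma> @ [s]) A')"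
  proof (rule sum.cong[OF refl])
    fix \<rho>
    assume \<rho>: "\<rho> \<in> ?D"
    note len\<rho> = distinguished_length[OF \<rho>]
    have "?\<delta> \<rho> id \<noteq> ?\<delta> \<rho> s"
      by (rule last_signs_opposite[OF assms(1,3) distinguished_letters[OF \<rho> expr] s])
    note expansion = single_step_expansion[where \<delta> = "?\<delta> \<rho>", OF s_id t this, of R ?\<epsilon>]
    have "((- 1) ^ ?n \<rho> * walk_L R \<rho> \<sigma> A') * step_factor R ?\<epsilon> t s =
      (\<Sum>u\<in>admissible_letters s t ?\<epsilon> (?\<delta> \<rho>).
        ((- 1) ^ ?n \<rho> * walk_L R \<rho> \<sigma> A') * ((- 1) ^ ?m \<rho> u * step_factor R (?\<delta> \<rho> u) u s))"
      by (simp only: expansion sum_distrib_left)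
    also have "\<dots> = (\<Sum>u\<in>admissible_letters s t ?\<epsilon> (?\<delta> \<rho>).
        (- 1) ^ card (sign_changes R A A' (\<rho> @ [u]) \<tau> (\<sigma> @ [s])) *
        walk_L R (\<rho> @ [u]) (\<sigma> @ [s]) A')"
      by (simp only: \<tau> card_sign_changes_snoc[OF len\<rho> len] walk_L_snoc[OF len\<rho>] power_add
          mult.assoc times_minus_one_power_left[of "walk_L R \<rho> \<sigma> A'"])
    finally show "((- 1) ^ ?n \<rho> * walk_L R \<rho> \<sigma> A') * step_factor R ?\<epsilon> t s =
      (\<Sum>u\<in>admissible_letters s t ?\<epsilon> (?\<delta> \<rho>).
        (- 1) ^ card (sign_changes R A A' (\<rho> @ [u]) \<tau> (\<sigma> @ [s])) *
        walk_L R (\<rho> @ [u]) (\<sigma> @ [s]) A')" .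
  qed
  also have "\<dots> = (\<Sum>\<rho>\<in>distinguished R A A' \<tau> (\<sigma> @ [s]).
      (- 1) ^ card (sign_changes R A A' \<rho> \<tau> (\<sigma> @ [s])) * walk_L R \<rho> (\<sigma> @ [s]) A')"
    by (simp only: \<tau> sum_distinguished_snoc[OF snoc.prems(2)[unfolded \<tau>]])
  finally show ?case .
qed

end
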